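(* Let $G=(V,E)$ be a finite, connected, undirected graph (multiple edges allowed) with at least one edge, and suppose $\theta(G)=\frac{p}{q}$. Let $y\in\mathbb{R}^E_{\ge 0}$ be the constant vector $y\equiv\frac{p}{q}$ and let $x$ be a $P(f)$-basis of $y$. Then $E$ is tight with respect to $x$, i.e., $x(E)=f(E)$.
   Context: $\Gamma$ denotes the set of spanning trees of $G$ (as edge sets). For $J\subseteq E$, $\mathcal{M}(J)=\min_{\gamma\in\Gamma}|\gamma\cap J|$, $\theta(J)=\mathcal{M}(J)/|J|$ if $J\neq\emptyset$, $\theta(\emptyset)=0$, and $\theta(G)=\max_{J\subseteq E}\theta(J)$. The graphic rank function is $f(J)=|V|-Q(G_J)$, where $Q(G_J)$ is the number of connected components of $G_J=(V,J)$. For $x\in\mathbb{R}^E$ and $J\subseteq E$, $x(J)=\sum_{e\in J}x(e)$. $P(f)=\{x\in\mathbb{R}^E_{\ge 0}: x(J)\le f(J)\text{ for all }J\subseteq E\}$. For $y\in\mathbb{R}^E_{\ge 0}$, a $P(f)$-basis of $y$ is a vector $x\in P(f)$ with $x\le y$ (componentwise) that is maximal (componentwise) among such vectors. A set $S\subseteq E$ is tight with respect to $x$ if $x(S)=f(S)$. *)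

theory Defs
  imports Complex_Main
begin

text \<open>
  Undirected multigraphs: edges have their own identity, and \<open>ends\<close> maps each edge to its set of
  end vertices, so parallel edges are distinct edges with the same end set. A singleton end set is
  a loop.
\<close>

record ('v, 'e) multigraph =
  verts :: "'v set"
  edges :: "'e set"
  ends :: "'e \<Rightarrow> 'v set"

definition finite_multigraph :: "('v, 'e) multigraph \<Rightarrow> bool" where
  "finite_multigraph G \<longleftrightarrow>
     finite (verts G) \<and> finite (edges G) \<and>
     (\<forall>e\<in>edges G. ends G e \<subseteq> verts G \<and> card (ends G e) \<in> {1, 2})"

definition adj :: "('v, 'e) multigraph \<Rightarrow> 'e set \<Rightarrow> ('v \<times> 'v) set" where
  "adj G J = {(u, v). \<exists>e\<in>J. ends G e = {u, v}}"

definition joined :: "('v, 'e) multigraph \<Rightarrow> 'e set \<Rightarrow> ('v \<times> 'v) set" where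
  "joined G J = {(u, v). u \<in> verts G \<and> v \<in> verts G \<and> (u, v) \<in> (adj G J)\<^sup>*}"

text \<open>The spanning subgraph with edge set \<open>J\<close> keeps every vertex, including the isolated ones.\<close>

definition connected_by :: "('v, 'e) multigraph \<Rightarrow> 'e set \<Rightarrow> bool" where
  "connected_by G J \<longleftrightarrow> verts G \<noteq> {} \<and> (\<forall>u\<in>verts G. \<forall>v\<in>verts G. (u, v) \<in> joined G J)"

definition num_components :: "('v, 'e) multigraph \<Rightarrow> 'e set \<Rightarrow> nat" where
  "num_components G J = card (verts G // joined G J)"

text \<open>
  \<open>vs\<close> and \<open>es\<close> list the vertices and edges in cyclic order. A loop is a cycle of length one, and
  a pair of parallel edges is a cycle of length two.
\<close>

definition is_cycle :: "('v, 'e) multigraph \<Rightarrow> 'v list \<Rightarrow> 'e list \<Rightarrow> bool" where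
  "is_cycle G vs es \<longleftrightarrow>
     es \<noteq> [] \<and> length vs = length es \<and> distinct vs \<and> distinct es \<and>
     (\<forall>i<length es. ends G (es ! i) = {vs ! i, vs ! (Suc i mod length es)})"

definition acyclic_edges :: "('v, 'e) multigraph \<Rightarrow> 'e set \<Rightarrow> bool" where
  "acyclic_edges G J \<longleftrightarrow> \<not> (\<exists>vs es. is_cycle G vs es \<and> set es \<subseteq> J)"

definition spanning_trees :: "('v, 'e) multigraph \<Rightarrow> 'e set set" where
  "spanning_trees G = {T. T \<subseteq> edges G \<and> connected_by G T \<and> acyclic_edges G T}"

definition min_overlap :: "('v, 'e) multigraph \<Rightarrow> 'e set \<Rightarrow> nat" where
  "min_overlap G J = Min ((\<lambda>T. card (T \<inter> J)) ` spanning_trees G)"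

definition theta_set :: "('v, 'e) multigraph \<Rightarrow> 'e set \<Rightarrow> real" where
  "theta_set G J = (if J = {} then 0 else real (min_overlap G J) / real (card J))"

definition theta :: "('v, 'e) multigraph \<Rightarrow> real" where
  "theta G = Max (theta_set G ` Pow (edges G))"

definition graphic_rank :: "('v, 'e) multigraph \<Rightarrow> 'e set \<Rightarrow> real" where
  "graphic_rank G J = real (card (verts G)) - real (num_components G J)"

text \<open>
  Vectors indexed by a finite set \<open>E\<close> are functions of which only the values on \<open>E\<close> matter.
\<close>

definition polyhedron :: "'e set \<Rightarrow> ('e set \<Rightarrow> real) \<Rightarrow> ('e \<Rightarrow> real) set" where
  "polyhedron E f = {x. (\<forall>e\<in>E. 0 \<le> x e) \<and> (\<forall>J\<subseteq>E. sum x J \<le> f J)}"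

definition is_basis :: "'e set \<Rightarrow> ('e set \<Rightarrow> real) \<Rightarrow> ('e \<Rightarrow> real) \<Rightarrow> ('e \<Rightarrow> real) \<Rightarrow> bool" where
  "is_basis E f y x \<longleftrightarrow>
     x \<in> polyhedron E f \<and> (\<forall>e\<in>E. x e \<le> y e) \<and>
     (\<forall>z\<in>polyhedron E f. (\<forall>e\<in>E. z e \<le> y e) \<and> (\<forall>e\<in>E. x e \<le> z e) \<longrightarrow> (\<forall>e\<in>E. z e = x e))"

definition tight :: "('e set \<Rightarrow> real) \<Rightarrow> ('e \<Rightarrow> real) \<Rightarrow> 'e set \<Rightarrow> bool" where
  "tight f x S \<longleftrightarrow> sum x S = f S"

end

theory Submission
  imports Defs
begin

text \<open>
  Tight sets are closed under union because the rank function \<open>f\<close> is submodular, and an edge outside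
  every tight set carries its full value \<open>\<theta>\<close> by maximality of \<open>x\<close>. So there is one tight set \<open>S\<close>
  with \<open>x(E) = f(S) + \<theta> |E - S|\<close>. A spanning tree has rank \<open>f(E)\<close> and hence meets \<open>E - S\<close> in at
  least \<open>f(E) - f(S)\<close> edges, so \<open>\<theta> |E - S| \<ge> f(E) - f(S)\<close> and \<open>x(E) \<ge> f(E)\<close>.
\<close>

section \<open>Bases in a submodular polyhedron\<close>

text \<open>Since \<open>x\<close> is modular and \<open>f\<close> submodular, the slacks
  \<open>f - x\<close> of the union and the intersection add up to at most the slacks of
  \<open>A\<close> and \<open>B\<close>, that is, to at most zero. Membership in the polyhedron
  makes both nonnegative, so both vanish.\<close>

lemma tight_Un:
  assumes "finite E" and "x \<in> polyhedron E f"
    and submod: "f (A \<union> B) + f (A \<inter> B) \<le> f A + f B"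
    and "A \<subseteq> E" "B \<subseteq> E" "tight f x A" "tight f x B"
  shows "tight f x (A \<union> B)"
proof -
  have "finite A" "finite B"
    using assms by (auto intro: finite_subset)
  then have "sum x (A \<union> B) + sum x (A \<inter> B) = sum x A + sum x B"
    by (rule sum.union_inter)
  moreover have "sum x (A \<union> B) \<le> f (A \<union> B)"
    using assms unfolding polyhedron_def by blast
  moreover have "sum x (A \<inter> B) \<le> f (A \<inter> B)"
    using \<open>x \<in> polyhedron E f\<close> \<open>A \<subseteq> E\<close> unfolding polyhedron_def by blast
  ultimately show ?thesis
    using assms unfolding tight_def by linarith
qed

text \<open>Raising \<open>x\<close> at \<open>e\<close> alone is limited only by \<open>y e\<close>
  and by the sets containing \<open>e\<close>. If all of these leave room, a small increase stays
  feasible and contradicts maximality.\<close>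

lemma is_basis_saturated:
  assumes "finite E" and basis: "is_basis E f y x" and "e \<in> E"
    and not_tight: "\<And>J. J \<subseteq> E \<Longrightarrow> e \<in> J \<Longrightarrow> \<not> tight f x J"
  shows "x e = y e"
proof (rule ccontr)
  assume "x e \<noteq> y e"
  have le: "sum x J \<le> f J" if "J \<subseteq> E" for J
    using basis that unfolding is_basis_def polyhedron_def by blast
  \<comment> \<open>\<open>D\<close> collects every slack that limits an increase at
    \<open>e\<close>. It is finite with positive members, so \<open>Min D\<close> is a positive
    increment respecting all the bounds at once.\<close>
  define D where "D = insert (y e - x e) ((\<lambda>J. f J - sum x J) ` {J. J \<subseteq> E \<and> e \<in> J})"
  define z where "z = x(e := x e + Min D)"
  have "finite D"
    unfolding D_def using \<open>finite E\<close> by simp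
  have "0 < d" if "d \<in> D" for d
  proof -
    have "x e < y e"
      using basis \<open>e \<in> E\<close> \<open>x e \<noteq> y e\<close> unfolding is_basis_def by (simp add: less_le)
    moreover have "sum x J < f J" if "J \<subseteq> E" "e \<in> J" for J
      using le[OF that(1)] not_tight[OF that] unfolding tight_def by simp
    moreover have "d = y e - x e \<or> (\<exists>J. J \<subseteq> E \<and> e \<in> J \<and> d = f J - sum x J)"
      using \<open>d \<in> D\<close> unfolding D_def by blast
    ultimately show ?thesis
      by fastforce
  qed
  moreover have "Min D \<in> D"
    using \<open>finite D\<close> by (rule Min_in) (simp add: D_def)
  ultimately have "0 < Min D"
    by blast
  have "sum z J \<le> f J" if "J \<subseteq> E" for J
  proof (cases "e \<in> J")
    case True
    have "finite J"
      using that \<open>finite E\<close> by (rule finite_subset)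
    have "sum z (J - {e}) = sum x (J - {e})"
      unfolding z_def by (rule sum.cong) auto
    then have "sum z J = sum x J + Min D"
      using True \<open>finite J\<close> by (simp add: sum.remove z_def)
    moreover have "Min D \<le> f J - sum x J"
      using \<open>finite D\<close> by (rule Min_le) (use True that in \<open>auto simp: D_def\<close>)
    ultimately show ?thesis
      by linarith
  next
    case False
    then have "sum z J = sum x J"
      unfolding z_def by (intro sum.cong) auto
    then show ?thesis
      using le[OF that] by simp
  qed
  moreover have "0 \<le> z a" if "a \<in> E" for a
    using basis that \<open>0 < Min D\<close> unfolding is_basis_def polyhedron_def z_def by auto
  ultimately have "z \<in> polyhedron E f"
    unfolding polyhedron_def by blast
  moreover have "Min D \<le> y e - x e"
    using \<open>finite D\<close> by (rule Min_le) (simp add: D_def)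
  then have "\<forall>a\<in>E. z a \<le> y a"
    using basis unfolding is_basis_def z_def by auto
  moreover have "\<forall>a\<in>E. x a \<le> z a"
    using \<open>0 < Min D\<close> unfolding z_def by auto
  ultimately have "z e = x e"
    using basis \<open>e \<in> E\<close> unfolding is_basis_def by blast
  then show False
    using \<open>0 < Min D\<close> unfolding z_def by simp
qed

text \<open>By closure under union, a maximal tight set absorbs every other one. An element outside
  it therefore lies in no tight set and is saturated.\<close>

lemma is_basis_tight_set:
  assumes "finite E" and "f {} = 0"
    and submod: "\<And>A B. A \<subseteq> E \<Longrightarrow> B \<subseteq> E \<Longrightarrow> f (A \<union> B) + f (A \<inter> B) \<le> f A + f B"
    and basis: "is_basis E f y x"
  obtains S where "S \<subseteq> E" "tight f x S" "\<And>e. e \<in> E - S \<Longrightarrow> x e = y e"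
proof -
  have poly: "x \<in> polyhedron E f"
    using basis unfolding is_basis_def by blast
  define \<T> where "\<T> = {S. S \<subseteq> E \<and> tight f x S}"
  have "finite \<T>"
    unfolding \<T>_def using \<open>finite E\<close> by simp
  moreover have "{} \<in> \<T>"
    unfolding \<T>_def tight_def using \<open>f {} = 0\<close> by simp
  ultimately obtain S where S: "S \<in> \<T>" and max: "\<And>T. T \<in> \<T> \<Longrightarrow> S \<subseteq> T \<Longrightarrow> T = S"
    using finite_has_maximal[of \<T>] by blast
  have "x e = y e" if e: "e \<in> E - S" for e
  proof (rule is_basis_saturated[OF \<open>finite E\<close> basis])
    show "e \<in> E"
      using e by blast
    show "\<not> tight f x J" if "J \<subseteq> E" "e \<in> J" for J
    proof
      assume "tight f x J"
      then have "S \<union> J \<in> \<T>"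
        using S that tight_Un[OF \<open>finite E\<close> poly submod] unfolding \<T>_def by blast
      then have "S \<union> J = S"
        using max by blast
      then show False
        using that e by blast
    qed
  qed
  then show ?thesis
    using S that unfolding \<T>_def by blast
qed

section \<open>The graphic rank function\<close>

lemma equiv_joined: "equiv (verts G) (joined G J)"
proof (rule equivI)
  show "joined G J \<subseteq> verts G \<times> verts G" and "refl_on (verts G) (joined G J)"
    unfolding joined_def refl_on_def by auto
  have "sym (adj G J)"
    unfolding adj_def sym_def by (auto simp: insert_commute)
  then show "sym (joined G J)"
    unfolding joined_def by (auto intro!: symI dest: symD[OF sym_rtrancl])
  show "trans (joined G J)"
    unfolding joined_def by (auto intro!: transI)
qed

lemma adj_mono: "J \<subseteq> K \<Longrightarrow> adj G J \<subseteq> adj G K"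
  unfolding adj_def by auto

lemma joined_mono: "J \<subseteq> K \<Longrightarrow> joined G J \<subseteq> joined G K"
  unfolding joined_def using rtrancl_mono[OF adj_mono] by blast

lemma adj_insert: "ends G e = {u, v} \<Longrightarrow> adj G (insert e J) = insert (u, v) (insert (v, u) (adj G J))"
  unfolding adj_def by (auto simp: doubleton_eq_iff)

text \<open>A walk through the new edge can be shortened to cross it at most once, in one of its two
  directions. The products of classes give exactly the form that \<open>card_quotient_merge\<close>
  expects.\<close>

lemma joined_insert:
  assumes "ends G e = {u, v}" "u \<in> verts G" "v \<in> verts G"
  shows "joined G (insert e J) = joined G J
    \<union> joined G J `` {u} \<times> joined G J `` {v} \<union> joined G J `` {v} \<times> joined G J `` {u}"
proof -
  have sym: "(a, b) \<in> joined G J \<longleftrightarrow> (b, a) \<in> joined G J" for a b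
    using equiv_joined by (metis equivE symD)
  have trans: "(a, b) \<in> joined G J \<Longrightarrow> (b, c) \<in> joined G J \<Longrightarrow> (a, c) \<in> joined G J" for a b c
    using equiv_joined by (metis equivE transD)
  \<comment> \<open>The edge contributes two ordered pairs, so \<open>rtrancl_insert\<close> applies
    twice; the cases with two crossings collapse by transitivity.\<close>
  have "(a, b) \<in> joined G (insert e J) \<longleftrightarrow> (a, b) \<in> joined G J
      \<or> (a, u) \<in> joined G J \<and> (v, b) \<in> joined G J \<or> (a, v) \<in> joined G J \<and> (u, b) \<in> joined G J" for a b
    unfolding joined_def using assms
    by (auto simp: adj_insert rtrancl_insert intro: rtrancl_trans)
  then show ?thesis
    using sym by auto
qed

text \<open>Here both products already lie in the relation. This covers loops (\<open>u = v\<close>)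
  and also justifies deleting an edge of a cycle.\<close>

lemma joined_insert_joined:
  assumes "ends G e = {u, v}" "(u, v) \<in> joined G J"
  shows "joined G (insert e J) = joined G J"
proof -
  have "u \<in> verts G" "v \<in> verts G"
    using assms(2) unfolding joined_def by auto
  moreover have "joined G J `` {u} \<times> joined G J `` {v} \<subseteq> joined G J"
    "joined G J `` {v} \<times> joined G J `` {u} \<subseteq> joined G J"
    using equiv_joined[of G J] assms(2) unfolding equiv_def
    by (auto dest: symD transD) (meson symD transD)+
  ultimately show ?thesis
    using joined_insert[OF assms(1)] by blast
qed

text \<open>The distinct classes of \<open>u\<close> and \<open>v\<close> fuse into one and all
  others survive: two classes go, one comes.\<close>

lemma card_quotient_merge:
  assumes "finite V" "equiv V R" "u \<in> V" "v \<in> V" "(u, v) \<notin> R"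
    and R': "R' = R \<union> R `` {u} \<times> R `` {v} \<union> R `` {v} \<times> R `` {u}"
  shows "card (V // R) = Suc (card (V // R'))"
proof -
  have sym: "(a, b) \<in> R \<Longrightarrow> (b, a) \<in> R" for a b
    using assms(2) by (metis equivE symD)
  have trans: "(a, b) \<in> R \<Longrightarrow> (b, c) \<in> R \<Longrightarrow> (a, c) \<in> R" for a b c
    using assms(2) by (metis equivE transD)
  have refl: "a \<in> V \<Longrightarrow> (a, a) \<in> R" for a
    using assms(2) by (metis equivE refl_onD)
  let ?U = "R `` {u}" and ?W = "R `` {v}"
  have image: "R' `` {a} = (if a \<in> ?U \<union> ?W then ?U \<union> ?W else R `` {a})" for a
  proof -
    have "R' `` {a} = R `` {a} \<union> (if a \<in> ?U then ?W else {}) \<union> (if a \<in> ?W then ?U else {})"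
      unfolding R' by auto
    moreover have "R `` {a} = ?U" if "a \<in> ?U"
      using that equiv_class_eq[OF assms(2)] by blast
    moreover have "R `` {a} = ?W" if "a \<in> ?W"
      using that equiv_class_eq[OF assms(2)] by blast
    ultimately show ?thesis
      by auto
  qed
  have "V // R' = insert (?U \<union> ?W) (V // R - {?U, ?W})"
  proof (intro equalityI subsetI)
    fix X assume "X \<in> V // R'"
    then obtain a where a: "a \<in> V" "X = R' `` {a}"
      by (rule quotientE)
    show "X \<in> insert (?U \<union> ?W) (V // R - {?U, ?W})"
    proof (cases "a \<in> ?U \<union> ?W")
      case False
      then have "X = R `` {a}" "X \<noteq> ?U" "X \<noteq> ?W"
        using a image refl by auto
      then show ?thesis
        using a by (auto intro: quotientI)
    qed (use a image in auto)
  next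
    fix X assume X: "X \<in> insert (?U \<union> ?W) (V // R - {?U, ?W})"
    show "X \<in> V // R'"
    proof (cases "X = ?U \<union> ?W")
      case True
      then have "X = R' `` {u}"
        using image refl \<open>u \<in> V\<close> by auto
      then show ?thesis
        using \<open>u \<in> V\<close> by (auto intro: quotientI)
    next
      case False
      then have X: "X \<in> V // R" "X \<noteq> ?U" "X \<noteq> ?W"
        using X by simp_all
      from X(1) obtain a where a: "a \<in> V" "X = R `` {a}"
        by (rule quotientE)
      then have "a \<notin> ?U \<union> ?W"
        using X(2,3) equiv_class_eq[OF assms(2)] by blast
      then have "X = R' `` {a}"
        using image a by auto
      then show ?thesis
        using a by (auto intro: quotientI)
    qed
  qed
  \<comment> \<open>The fused class must be new for its insertion to raise the cardinality by
    one.\<close>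
  moreover have "?U \<union> ?W \<notin> V // R"
  proof
    assume "?U \<union> ?W \<in> V // R"
    then obtain a where "?U \<union> ?W = R `` {a}"
      by (rule quotientE)
    then have "(a, u) \<in> R" "(a, v) \<in> R"
      using refl assms(3,4) by blast+
    then have "(u, v) \<in> R"
      using sym trans by blast
    then show False
      using assms(5) by simp
  qed
  moreover have "?U \<noteq> ?W"
    using assms refl by blast
  moreover have "?U \<in> V // R" "?W \<in> V // R"
    using assms by (auto intro: quotientI)
  moreover have "finite (V // R)"
    using assms unfolding equiv_def by (simp add: finite_quotient)
  \<comment> \<open>This keeps the subtraction of two on natural numbers from truncating.\<close>
  moreover have "card {?U, ?W} \<le> card (V // R)"
    using calculation by (intro card_mono) auto
  ultimately show ?thesis
    by (simp add: card_Diff_subset)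
qed

section \<open>Rank increments and submodularity\<close>

lemma finite_multigraph_ends:
  assumes "finite_multigraph G" "e \<in> edges G"
  obtains u v where "ends G e = {u, v}" "u \<in> verts G" "v \<in> verts G"
proof -
  have "card (ends G e) = 1 \<or> card (ends G e) = 2" "ends G e \<subseteq> verts G"
    using assms unfolding finite_multigraph_def by auto
  then show ?thesis
    using that by (fastforce simp: card_1_singleton_iff card_2_iff)
qed

text \<open>A new edge either stays inside a component or merges two. The rank bounds and the
  diminishing gain below are inductions on this increment.\<close>

lemma graphic_rank_insert:
  assumes "finite_multigraph G" "ends G e = {u, v}" "u \<in> verts G" "v \<in> verts G"
  shows "graphic_rank G (insert e J) = graphic_rank G J + (if (u, v) \<in> joined G J then 0 else 1)"
proof (cases "(u, v) \<in> joined G J")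
  case True
  then show ?thesis
    using joined_insert_joined[OF assms(2)] by (simp add: graphic_rank_def num_components_def)
next
  case False
  have "finite (verts G)"
    using assms(1) unfolding finite_multigraph_def by blast
  then show ?thesis
    using card_quotient_merge[OF _ equiv_joined assms(3,4) False joined_insert[OF assms(2-4)]] False
    by (simp add: graphic_rank_def num_components_def)
qed

lemma graphic_rank_empty: "graphic_rank G {} = 0"
proof -
  have "joined G {} = Id_on (verts G)"
    unfolding joined_def adj_def by auto
  then have "verts G // joined G {} = (\<lambda>v. {v}) ` verts G"
    unfolding quotient_def by auto
  then show ?thesis
    by (simp add: graphic_rank_def num_components_def card_image)
qed

lemma graphic_rank_Un_bounds:
  assumes "finite_multigraph G" "finite C" "C \<subseteq> edges G"
  shows "graphic_rank G A \<le> graphic_rank G (A \<union> C)"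
    and "graphic_rank G (A \<union> C) \<le> graphic_rank G A + real (card C)"
proof -
  have "graphic_rank G A \<le> graphic_rank G (A \<union> C)
      \<and> graphic_rank G (A \<union> C) \<le> graphic_rank G A + real (card C)"
    using assms(2,3)
  proof (induction C)
    case (insert e C)
    obtain u v where "ends G e = {u, v}" "u \<in> verts G" "v \<in> verts G"
      using finite_multigraph_ends[OF assms(1)] insert.prems by blast
    from graphic_rank_insert[OF assms(1) this, of "A \<union> C"] show ?case
      using insert by (auto split: if_splits)
  qed simp
  then show "graphic_rank G A \<le> graphic_rank G (A \<union> C)"
    and "graphic_rank G (A \<union> C) \<le> graphic_rank G A + real (card C)"
    by blast+
qed

text \<open>Diminishing returns: the larger set joins at least the same pairs, so an edge that gains
  over \<open>B\<close> also gains over \<open>A\<close>.\<close>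

lemma graphic_rank_gain_antimono:
  assumes "finite_multigraph G" "finite C" "C \<subseteq> edges G" "A \<subseteq> B"
  shows "graphic_rank G (B \<union> C) - graphic_rank G B \<le> graphic_rank G (A \<union> C) - graphic_rank G A"
  using assms(2,3)
proof (induction C)
  case (insert e C)
  obtain u v where uv: "ends G e = {u, v}" "u \<in> verts G" "v \<in> verts G"
    using finite_multigraph_ends[OF assms(1)] insert.prems by blast
  have "joined G (A \<union> C) \<subseteq> joined G (B \<union> C)"
    using \<open>A \<subseteq> B\<close> by (intro joined_mono) blast
  then show ?case
    using insert graphic_rank_insert[OF assms(1) uv, of "A \<union> C"]
      graphic_rank_insert[OF assms(1) uv, of "B \<union> C"] by (auto split: if_splits)
qed simp

lemma graphic_rank_submodular:
  assumes "finite_multigraph G" "A \<subseteq> edges G"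
  shows "graphic_rank G (A \<union> B) + graphic_rank G (A \<inter> B) \<le> graphic_rank G A + graphic_rank G B"
proof -
  have "finite A"
    using assms unfolding finite_multigraph_def by (auto intro: finite_subset)
  \<comment> \<open>Adding \<open>A\<close> to \<open>A \<inter> B\<close> yields \<open>A\<close>,
    and adding it to \<open>B\<close> yields the union; comparing the two gains is
    submodularity.\<close>
  from graphic_rank_gain_antimono[OF assms(1) this assms(2), of "A \<inter> B" B]
  show ?thesis
    by (simp add: Un_commute Un_absorb1)
qed

section \<open>Spanning trees\<close>

text \<open>The remaining edges of the cycle form a path between the ends of the last one; for a
  loop this path is trivial.\<close>

lemma is_cycle_last_edge:
  assumes "is_cycle G vs es" "set es \<subseteq> J" "set vs \<subseteq> verts G"
  shows "ends G (last es) = {last vs, hd vs}"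
    and "(last vs, hd vs) \<in> joined G (J - {last es})"
proof -
  let ?n = "length es"
  have c: "es \<noteq> []" "length vs = ?n" "distinct es"
    "\<And>i. i < ?n \<Longrightarrow> ends G (es ! i) = {vs ! i, vs ! (Suc i mod ?n)}"
    using assms(1) unfolding is_cycle_def by auto
  then have "vs \<noteq> []"
    by auto
  then have ends: "last es = es ! (?n - 1)" "last vs = vs ! (?n - 1)" "hd vs = vs ! 0"
    using c by (simp_all add: last_conv_nth hd_conv_nth)
  show "ends G (last es) = {last vs, hd vs}"
    using c(4)[of "?n - 1"] c(1) by (simp add: ends)
  have "(vs ! 0, vs ! i) \<in> (adj G (J - {last es}))\<^sup>*" if "i < ?n" for i
    using that
  proof (induction i)
    case (Suc i)
    \<comment> \<open>As \<open>Suc i < ?n\<close>, the index \<open>i\<close> is not the last one,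
      so distinctness separates the two edges; for the same reason the \<open>mod\<close> below does
      not wrap around.\<close>
    have "es ! i \<in> J - {last es}"
      using Suc.prems assms(2) c(1,3) by (auto simp: ends nth_eq_iff_index_eq)
    moreover have "ends G (es ! i) = {vs ! i, vs ! Suc i}"
      using c(4)[of i] Suc.prems by simp
    ultimately have "(vs ! i, vs ! Suc i) \<in> adj G (J - {last es})"
      unfolding adj_def by blast
    then show ?case
      using Suc by (auto intro: rtrancl_into_rtrancl)
  qed simp
  then have "(hd vs, last vs) \<in> joined G (J - {last es})"
    using assms(3) \<open>vs \<noteq> []\<close> c(1) by (auto simp: joined_def ends c(2) subset_iff)
  then show "(last vs, hd vs) \<in> joined G (J - {last es})"
    using equiv_joined by (metis equivE symD)
qed

text \<open>A minimal connected edge set is acyclic, since deleting an edge of a cycle preserves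
  connectivity. Nonemptiness ensures that the \<open>Min\<close> in \<open>min_overlap\<close> is
  attained by a tree.\<close>

lemma spanning_trees_nonempty:
  assumes "finite_multigraph G" "connected_by G (edges G)"
  shows "spanning_trees G \<noteq> {}"
proof -
  define \<C> where "\<C> = {T. T \<subseteq> edges G \<and> connected_by G T}"
  have "finite \<C>" "edges G \<in> \<C>"
    unfolding \<C>_def using assms unfolding finite_multigraph_def by auto
  then obtain T where "T \<in> \<C>" and min: "\<And>T'. T' \<in> \<C> \<Longrightarrow> T' \<subseteq> T \<Longrightarrow> T' = T"
    using finite_has_minimal[of \<C>] by blast
  then have T: "T \<subseteq> edges G" "connected_by G T"
    unfolding \<C>_def by blast+
  have "acyclic_edges G T"
    unfolding acyclic_edges_def
  proof (intro notI, elim exE conjE)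
    fix vs es assume cycle: "is_cycle G vs es" "set es \<subseteq> T"
    have "last es \<in> T"
      using cycle unfolding is_cycle_def by auto
    \<comment> \<open>\<open>is_cycle\<close> does not itself place its vertices in the graph; they
      lie there as ends of edges of \<open>G\<close>.\<close>
    have "v \<in> verts G" if "v \<in> set vs" for v
    proof -
      obtain i where i: "i < length es" "v = vs ! i"
        using cycle(1) \<open>v \<in> set vs\<close> unfolding is_cycle_def by (metis in_set_conv_nth)
      then have "v \<in> ends G (es ! i)" "es ! i \<in> edges G"
        using cycle T unfolding is_cycle_def by (auto simp: subset_iff)
      then show ?thesis
        using assms(1) unfolding finite_multigraph_def by blast
    qed
    then have "set vs \<subseteq> verts G"
      by blast
    from joined_insert_joined[OF is_cycle_last_edge[OF cycle this]]
    have "joined G (T - {last es}) = joined G T"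
      using \<open>last es \<in> T\<close> by (simp add: insert_absorb)
    then have "T - {last es} \<in> \<C>"
      using T unfolding \<C>_def connected_by_def by auto
    then show False
      using min \<open>last es \<in> T\<close> by blast
  qed
  then show ?thesis
    using T unfolding spanning_trees_def by blast
qed

section \<open>Spanning trees against rank and \<theta>\<close>

lemma graphic_rank_connected:
  assumes "connected_by G J" "connected_by G K"
  shows "graphic_rank G J = graphic_rank G K"
proof -
  have "joined G J = joined G K"
    using assms unfolding connected_by_def joined_def by auto
  then show ?thesis
    by (simp add: graphic_rank_def num_components_def)
qed

text \<open>Take a tree \<open>T\<close> attaining the minimum. By monotonicity \<open>T - J\<close>
  has rank at most that of \<open>edges G - J\<close>, and adding the edges of
  \<open>T \<inter> J\<close> raises it by at most one each, up to full rank.\<close>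

lemma min_overlap_ge:
  assumes "finite_multigraph G" "connected_by G (edges G)"
  shows "graphic_rank G (edges G) - graphic_rank G (edges G - J) \<le> real (min_overlap G J)"
proof -
  have fin: "finite (edges G)"
    using assms(1) unfolding finite_multigraph_def by blast
  have "spanning_trees G \<subseteq> Pow (edges G)"
    unfolding spanning_trees_def by blast
  then have "finite (spanning_trees G)"
    using fin by (simp add: finite_subset)
  then have "min_overlap G J \<in> (\<lambda>T. card (T \<inter> J)) ` spanning_trees G"
    unfolding min_overlap_def using spanning_trees_nonempty[OF assms] by (intro Min_in) auto
  then obtain T where T: "T \<subseteq> edges G" "connected_by G T" "min_overlap G J = card (T \<inter> J)"
    unfolding spanning_trees_def by auto
  have "finite T"
    using T(1) fin by (rule finite_subset)
  have "graphic_rank G (edges G) = graphic_rank G ((T - J) \<union> (T \<inter> J))"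
    using graphic_rank_connected[OF assms(2) T(2)] by (simp add: Un_Diff_Int)
  also have "\<dots> \<le> graphic_rank G (T - J) + real (card (T \<inter> J))"
    using \<open>finite T\<close> T(1) by (intro graphic_rank_Un_bounds[OF assms(1)]) auto
  also have "graphic_rank G (T - J) \<le> graphic_rank G ((T - J) \<union> (edges G - J))"
    using fin by (intro graphic_rank_Un_bounds[OF assms(1)]) auto
  also have "(T - J) \<union> (edges G - J) = edges G - J"
    using T(1) by blast
  finally show ?thesis
    using T(3) by simp
qed

lemma min_overlap_le_theta:
  assumes "finite (edges G)" "J \<subseteq> edges G" "J \<noteq> {}"
  shows "real (min_overlap G J) \<le> theta G * real (card J)"
proof -
  have "theta_set G J \<le> theta G"
    unfolding theta_def using assms by (intro Max_ge) auto
  moreover have "0 < card J"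
    using assms by (simp add: card_gt_0_iff finite_subset)
  ultimately show ?thesis
    using assms(3) by (simp add: theta_set_def divide_le_eq)
qed

theorem theorem15:
  fixes G :: "('v, 'e) multigraph"
    and p q :: int
    and x y :: "'e \<Rightarrow> real"
  assumes "finite_multigraph G"
    and "connected_by G (edges G)"
    and "edges G \<noteq> {}"
    and "q \<noteq> 0"
    and "theta G = real_of_int p / real_of_int q"
    and "\<forall>e\<in>edges G. y e = real_of_int p / real_of_int q"
    and "is_basis (edges G) (graphic_rank G) y x"
  shows "tight (graphic_rank G) x (edges G)"
proof -
  let ?E = "edges G" and ?f = "graphic_rank G"
  have fin: "finite ?E"
    using assms(1) unfolding finite_multigraph_def by blast
  obtain S where S: "S \<subseteq> ?E" "tight ?f x S" "\<And>e. e \<in> ?E - S \<Longrightarrow> x e = y e"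
    using is_basis_tight_set[where f = ?f, OF fin graphic_rank_empty _ assms(7)]
      graphic_rank_submodular[OF assms(1)] by blast
  show ?thesis
  \<comment> \<open>The bound by \<theta> is applied to the complement of \<open>S\<close> and
    requires it to be nonempty; otherwise \<open>S\<close> is already all of
    \<open>?E\<close>.\<close>
  proof (cases "?E - S = {}")
    case True
    then show ?thesis
      using S by (metis Diff_eq_empty_iff subset_antisym)
  next
    case False
    have "?E - (?E - S) = S"
      using S(1) by blast
    then have "?f ?E - ?f S \<le> theta G * real (card (?E - S))"
      using min_overlap_ge[OF assms(1,2), of "?E - S"] min_overlap_le_theta[OF fin _ False] by force
    \<comment> \<open>Off \<open>S\<close> the basis agrees with \<open>y\<close>, whose constant
      value is \<open>theta G\<close>.\<close>
    also have "\<dots> = sum x (?E - S)"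
      using S(3) assms(5,6) by simp
    also have "\<dots> = sum x ?E - ?f S"
      using S(1,2) fin by (simp add: sum_diff tight_def)
    finally have "?f ?E \<le> sum x ?E"
      by simp
    moreover have "sum x ?E \<le> ?f ?E"
      using assms(7) unfolding is_basis_def polyhedron_def by blast
    ultimately show ?thesis
      unfolding tight_def by simp
  qed
qed

end
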